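(* Let $k$ be a positive integer. For every integer $n\ge 1$, $$v_k(n)=(k+1)\,e_k(n)=\frac{k+1}{kn+1}\binom{kn+n}{n}.$$
   Context: All paths are lattice paths in $\mathbb{Z}^2$ composed only of unit steps to the right $(1,0)$ and up $(0,1)$. The diagonal is the line $y=x/k$. An excursion of size $n$ is a path from $(0,0)$ to $(kn,n)$ that stays weakly above the diagonal; $e_k(n)$ denotes the number of excursions of size $n$. A valved path is a path that does not cross from on or above the diagonal to below the diagonal, except possibly with its first step; equivalently, no right step other than possibly the first step of the path starts at a point on or above the diagonal and ends at a point strictly below the diagonal. $v_k(n)$ denotes the number of valved paths from $(0,0)$ to $(kn,n)$. *)

theory Defs
  imports Complex_Main "HOL-Library.Product_Plus"
begin

datatype step = RightStep | UpStep

fun step_vec :: "step \<Rightarrow> int \<times> int" where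
  "step_vec RightStep = (1, 0)"
| "step_vec UpStep = (0, 1)"

text \<open>A lattice path starting at the origin is given by its list of steps;
  \<open>vertex p i\<close> is the lattice point reached after the first \<open>i\<close> steps.\<close>

definition vertex :: "step list \<Rightarrow> nat \<Rightarrow> int \<times> int" where
  "vertex p i = sum_list (map step_vec (take i p))"

definition paths_to :: "int \<times> int \<Rightarrow> step list set" where
  "paths_to P = {p. vertex p (length p) = P}"

definition weakly_above_diag :: "nat \<Rightarrow> int \<times> int \<Rightarrow> bool" where
  "weakly_above_diag k P \<longleftrightarrow> real_of_int (snd P) \<ge> real_of_int (fst P) / real k"

definition strictly_below_diag :: "nat \<Rightarrow> int \<times> int \<Rightarrow> bool" where
  "strictly_below_diag k P \<longleftrightarrow> real_of_int (snd P) < real_of_int (fst P) / real k"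

text \<open>As a half-plane is convex, a path stays weakly above the diagonal iff all its
  vertices do.\<close>

definition excursions :: "nat \<Rightarrow> nat \<Rightarrow> step list set" where
  "excursions k n =
    {p \<in> paths_to (int (k * n), int n). \<forall>i\<le>length p. weakly_above_diag k (vertex p i)}"

definition num_excursions :: "nat \<Rightarrow> nat \<Rightarrow> nat" where
  "num_excursions k n = card (excursions k n)"

text \<open>The step \<open>p ! i\<close> leads from \<open>vertex p i\<close> to \<open>vertex p (Suc i)\<close>. The first step,
  \<open>p ! 0\<close>, is exempt from the condition.\<close>

definition valved :: "nat \<Rightarrow> step list \<Rightarrow> bool" where
  "valved k p \<longleftrightarrow>
    \<not> (\<exists>i. 0 < i \<and> i < length p \<and> p ! i = RightStep \<and>
          weakly_above_diag k (vertex p i) \<and> strictly_below_diag k (vertex p (Suc i)))"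

definition valved_paths :: "nat \<Rightarrow> nat \<Rightarrow> step list set" where
  "valved_paths k n = {p \<in> paths_to (int (k * n), int n). valved k p}"

definition num_valved :: "nat \<Rightarrow> nat \<Rightarrow> nat" where
  "num_valved k n = card (valved_paths k n)"

text \<open>The cardinalities above are those of finite sets.\<close>

lemma finite_paths_to: "finite (paths_to P)"
proof -
  have len: "fst (sum_list (map step_vec p)) + snd (sum_list (map step_vec p)) = int (length p)"
    for p
  proof (induction p)
    case (Cons s p)
    then show ?case by (cases s) auto
  qed simp
  have "UNIV = {RightStep, UpStep}"
    using step.exhaust by auto
  then have "finite (UNIV :: step set)"
    by (metis finite.emptyI finite.insertI)
  then have "finite {p :: step list. set p \<subseteq> UNIV \<and> length p = nat (fst P + snd P)}"
    by (rule finite_lists_length_eq)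
  moreover have "paths_to P \<subseteq> {p. set p \<subseteq> UNIV \<and> length p = nat (fst P + snd P)}"
    using len by (force simp: paths_to_def vertex_def)
  ultimately show ?thesis
    by (rule rev_finite_subset)
qed

lemma finite_excursions: "finite (excursions k n)"
  using finite_paths_to by (simp add: excursions_def)

lemma finite_valved_paths: "finite (valved_paths k n)"
  using finite_paths_to by (simp add: valved_paths_def)

end

theory Submission
  imports Defs "HOL-Library.Sublist"
begin

text \<open>A right step lowers the height \<open>k * y - x\<close> by 1, an up step raises it by \<open>k\<close>. A valved path
  starting upwards is an excursion. A valved path starting to the right is \<open>A @ UpStep # B\<close>, where
  \<open>A\<close> stays at negative height and ends at some height \<open>-j\<close> with \<open>1 \<le> j \<le> k\<close>, and \<open>B\<close> stays at
  nonnegative height. Then \<open>UpStep # rev A @ B\<close> is an excursion, and \<open>(A, B)\<close> is recovered from it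
  and \<open>j\<close> since \<open>rev A\<close> ends at the first visit of height \<open>k - j\<close>. Hence there are \<open>k\<close> times as many
  such paths as excursions. Excursions are counted by a ballot recursion on the first step,
  for paths that start at an arbitrary height and end on the diagonal.\<close>

section \<open>Heights, and path conditions stated through prefixes\<close>

text \<open>Built from step counts alone, hence invariant under \<open>rev\<close>; the bijection
  with excursions reverses a segment.\<close>

definition height :: "nat \<Rightarrow> step list \<Rightarrow> int" where
  "height k p = int k * int (count_list p UpStep) - int (count_list p RightStep)"

lemma height_simps [simp]:
  "height k [] = 0"
  "height k (UpStep # p) = int k + height k p"
  "height k (RightStep # p) = height k p - 1"
  "height k (p @ q) = height k p + height k q"
  "height k (rev p) = height k p"
  by (simp_all add: height_def algebra_simps)

lemma sum_list_step_vec: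
  "sum_list (map step_vec p) = (int (count_list p RightStep), int (count_list p UpStep))"
proof (induction p)
  case (Cons s p)
  then show ?case by (cases s) auto
qed (simp add: zero_prod_def)

lemma paths_to_iff:
  "p \<in> paths_to (int a, int b) \<longleftrightarrow> count_list p RightStep = a \<and> count_list p UpStep = b"
  by (simp add: paths_to_def vertex_def sum_list_step_vec)

lemma weakly_above_diag_iff:
  assumes "k \<ge> 1"
  shows "weakly_above_diag k (vertex p i) \<longleftrightarrow> 0 \<le> height k (take i p)"
proof -
  have "weakly_above_diag k (vertex p i) \<longleftrightarrow>
      real (count_list (take i p) RightStep) \<le> real (k * count_list (take i p) UpStep)"
    using assms
    by (simp add: weakly_above_diag_def vertex_def sum_list_step_vec divide_le_eq mult.commute)
  then show ?thesis
    unfolding height_def of_nat_le_iff by (metis diff_ge_0_iff_ge of_nat_le_iff of_nat_mult)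
qed

lemma strictly_below_diag_iff:
  "k \<ge> 1 \<Longrightarrow> strictly_below_diag k (vertex p i) \<longleftrightarrow> height k (take i p) < 0"
  using weakly_above_diag_iff[of k p i]
  by (auto simp: strictly_below_diag_def weakly_above_diag_def)

lemma excursions_iff:
  assumes "k \<ge> 1"
  shows "p \<in> excursions k n \<longleftrightarrow>
    p \<in> paths_to (int (k * n), int n) \<and> (\<forall>q. prefix q p \<longrightarrow> 0 \<le> height k q)"
proof -
  have "(\<forall>i\<le>length p. 0 \<le> height k (take i p)) \<longleftrightarrow> (\<forall>q. prefix q p \<longrightarrow> 0 \<le> height k q)"
    by (metis append_eq_conv_conj prefix_def prefix_length_le take_is_prefix)
  then show ?thesis
    by (simp add: excursions_def weakly_above_diag_iff[OF assms])
qed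

text \<open>A right step lowers the height by exactly 1, so it crosses downwards precisely when it
  starts at height 0. The exempt first step is the case \<open>q = []\<close>.\<close>

lemma valved_iff:
  assumes "k \<ge> 1"
  shows "valved k p \<longleftrightarrow> (\<forall>q. q \<noteq> [] \<longrightarrow> prefix (q @ [RightStep]) p \<longrightarrow> height k q \<noteq> 0)"
proof
  assume v: "valved k p"
  show "\<forall>q. q \<noteq> [] \<longrightarrow> prefix (q @ [RightStep]) p \<longrightarrow> height k q \<noteq> 0"
  proof (intro allI impI notI)
    fix q assume q: "q \<noteq> []" "prefix (q @ [RightStep]) p" "height k q = 0"
    then obtain r where r: "p = q @ RightStep # r"
      by (auto simp: prefix_def)
    have "0 < length q" "length q < length p" "p ! length q = RightStep"
      "weakly_above_diag k (vertex p (length q))"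
      "strictly_below_diag k (vertex p (Suc (length q)))"
      using q by (simp_all add: r weakly_above_diag_iff[OF assms] strictly_below_diag_iff[OF assms])
    with v show False
      unfolding valved_def by blast
  qed
next
  assume h: "\<forall>q. q \<noteq> [] \<longrightarrow> prefix (q @ [RightStep]) p \<longrightarrow> height k q \<noteq> 0"
  have False if i: "0 < i" "i < length p" "p ! i = RightStep"
    "0 \<le> height k (take i p)" "height k (take (Suc i) p) < 0" for i
  proof -
    have t: "take (Suc i) p = take i p @ [RightStep]"
      using i by (simp add: take_Suc_conv_app_nth)
    then have "height k (take i p) = 0"
      using i by simp
    moreover have "take i p \<noteq> []" "prefix (take i p @ [RightStep]) p"
      using i t take_is_prefix[of "Suc i" p] by auto
    ultimately show False using h by blast
  qed
  then show "valved k p"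
    unfolding valved_def weakly_above_diag_iff[OF assms] strictly_below_diag_iff[OF assms]
    by blast
qed

lemma valved_paths_iff:
  assumes "k \<ge> 1"
  shows "p \<in> valved_paths k n \<longleftrightarrow> p \<in> paths_to (int (k * n), int n) \<and>
    (\<forall>q. q \<noteq> [] \<longrightarrow> prefix (q @ [RightStep]) p \<longrightarrow> height k q \<noteq> 0)"
  by (simp add: valved_paths_def valved_iff[OF assms])

lemma height_paths_to: "p \<in> paths_to (int (k * n), int n) \<Longrightarrow> height k p = 0"
  unfolding paths_to_iff height_def by simp

text \<open>First-passage principle: it locates the first return to nonnegative height and the first
  visit to a given negative level.\<close>

lemma shortest_prefix:
  assumes "P p"
  obtains r where "prefix r p" "P r" "\<And>q. strict_prefix q r \<Longrightarrow> \<not> P q"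
proof -
  obtain r where "prefix r p \<and> P r" "\<And>q. prefix q p \<and> P q \<Longrightarrow> length r \<le> length q"
    using ex_has_least_nat[of "\<lambda>r. prefix r p \<and> P r" p length] assms by auto
  then show thesis
    using that[of r] by (meson leD prefix_length_less prefix_order.less_imp_le prefix_order.trans)
qed

section \<open>Persistence of nonnegative height, and valved paths that start upwards\<close>

text \<open>Only right steps lower the height, by 1, and none of them may start at height 0. The
  hypothesis \<open>A \<noteq> []\<close> puts the exempt first step inside
  \<open>A\<close>.\<close>

lemma valved_stays_nonneg:
  assumes "\<And>q. q \<noteq> [] \<Longrightarrow> prefix (q @ [RightStep]) (A @ B) \<Longrightarrow> height k q \<noteq> 0"
    and "A \<noteq> []" "0 \<le> height k A" "prefix q B"
  shows "0 \<le> height k (A @ q)"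
  using assms(4)
proof (induction q rule: rev_induct)
  case Nil
  then show ?case using assms(3) by simp
next
  case (snoc s q)
  have IH: "0 \<le> height k (A @ q)"
    using snoc append_prefixD by blast
  show ?case
  proof (cases s)
    case RightStep
    have "prefix ((A @ q) @ [RightStep]) (A @ B)"
      using snoc.prems RightStep by simp
    then have "height k (A @ q) \<noteq> 0"
      using assms(1)[of "A @ q"] assms(2) by blast
    then show ?thesis using IH RightStep by simp
  qed (use IH in simp)
qed

lemma paths_to_neq_Nil: "p \<in> paths_to (int a, int n) \<Longrightarrow> n \<ge> 1 \<Longrightarrow> p \<noteq> []"
  by (auto simp: paths_to_iff)

lemma excursion_starts_up:
  assumes "k \<ge> 1" "n \<ge> 1" "p \<in> excursions k n"
  obtains p' where "p = UpStep # p'"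
proof (cases p)
  case Nil
  then show ?thesis
    using assms paths_to_neq_Nil[of p "k * n" n] by (simp add: excursions_iff)
next
  case (Cons s p')
  have "prefix [s] p" using Cons by simp
  then have "0 \<le> height k [s]"
    using assms by (auto simp: excursions_iff)
  then show ?thesis using that Cons by (cases s) auto
qed

text \<open>After the first step up the height is \<open>k\<close>, and nonnegativity persists.
  Conversely, a right step of an excursion ends at nonnegative height, so it starts at positive
  height.\<close>

lemma valved_up_eq_excursions:
  assumes "k \<ge> 1" "n \<ge> 1"
  shows "{p \<in> valved_paths k n. hd p = UpStep} = excursions k n"
proof (intro equalityI subsetI)
  fix p assume p: "p \<in> {p \<in> valved_paths k n. hd p = UpStep}"
  then have pt: "p \<in> paths_to (int (k * n), int n)"
    using assms by (simp add: valved_paths_iff)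
  then obtain p' where p': "p = [UpStep] @ p'"
    using p paths_to_neq_Nil[OF pt] assms by (cases p) auto
  have "0 \<le> height k q" if "prefix q p" for q
  proof (cases q)
    case (Cons s q')
    then have "q = [UpStep] @ q'" "prefix q' p'"
      using that p' by auto
    moreover have "0 \<le> height k ([UpStep] @ q')" if "prefix q' p'"
      by (rule valved_stays_nonneg[OF _ _ _ that])
        (use p p' assms in \<open>auto simp: valved_paths_iff\<close>)
    ultimately show ?thesis by blast
  qed simp
  then show "p \<in> excursions k n"
    using pt assms by (simp add: excursions_iff)
next
  fix p assume p: "p \<in> excursions k n"
  obtain p' where p': "p = UpStep # p'"
    using excursion_starts_up[OF assms p] .
  have "height k q \<noteq> 0" if "prefix (q @ [RightStep]) p" for q
  proof -
    have "0 \<le> height k (q @ [RightStep])"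
      using p that assms by (simp add: excursions_iff del: height_simps)
    then show ?thesis by simp
  qed
  then show "p \<in> {p \<in> valved_paths k n. hd p = UpStep}"
    using p p' assms by (simp add: valved_paths_iff excursions_iff)
qed

section \<open>Valved paths that start to the right\<close>

text \<open>The two sides of the up step that first returns to nonnegative height. The prefix
  \<open>[]\<close> of \<open>B\<close> bounds the depth \<open>- height k A\<close> by
  \<open>k\<close>, and the prefix \<open>A\<close> of itself makes it at least 1.\<close>

definition valley_pairs :: "nat \<Rightarrow> nat \<Rightarrow> (step list \<times> step list) set" where
  "valley_pairs k n = {(A, B). A @ UpStep # B \<in> paths_to (int (k * n), int n) \<and> A \<noteq> [] \<and>
     (\<forall>q. prefix q A \<longrightarrow> q \<noteq> [] \<longrightarrow> height k q < 0) \<and>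
     (\<forall>q. prefix q B \<longrightarrow> 0 \<le> height k A + int k + height k q)}"

text \<open>The cut is forced: it is the first time after the start at which the height is
  nonnegative.\<close>

lemma valved_right_bij:
  assumes "k \<ge> 1" "n \<ge> 1"
  shows "bij_betw (\<lambda>(A, B). A @ UpStep # B) (valley_pairs k n)
    {p \<in> valved_paths k n. hd p = RightStep}"
  unfolding bij_betw_def
proof (intro conjI equalityI subsetI)
  \<comment> \<open>If \<open>A'\<close> were longer, the up step after \<open>A\<close> would lie
    inside \<open>A'\<close>, where heights are negative, although it reaches a nonnegative
    height.\<close>
  have longer: "length A' \<le> length A"
    if "(A, B) \<in> valley_pairs k n" "(A', B') \<in> valley_pairs k n"
      "A @ UpStep # B = A' @ UpStep # B'" for A B A' B'
  proof (rule ccontr)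
    assume "\<not> length A' \<le> length A"
    then have "prefix (A @ [UpStep]) A'"
      using that(3) by (auto simp: append_eq_append_conv2 Cons_eq_append_conv)
    then have "height k (A @ [UpStep]) < 0"
      using that(2) by (auto simp: valley_pairs_def simp del: height_simps)
    moreover have "0 \<le> height k A + int k + height k []"
      using that(1) unfolding valley_pairs_def by (auto simp del: height_simps)
    ultimately show False by simp
  qed
  show "inj_on (\<lambda>(A, B). A @ UpStep # B) (valley_pairs k n)"
  proof (rule inj_onI, clarify)
    fix A B A' B'
    assume "(A, B) \<in> valley_pairs k n" "(A', B') \<in> valley_pairs k n"
      "A @ UpStep # B = A' @ UpStep # B'"
    moreover from this have "length A = length A'"
      using longer[of A B A' B'] longer[of A' B' A B] by simp
    ultimately show "A = A' \<and> B = B'" by simp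
  qed
next
  fix p assume "p \<in> (\<lambda>(A, B). A @ UpStep # B) ` valley_pairs k n"
  then obtain A B where AB: "(A, B) \<in> valley_pairs k n" and p: "p = A @ UpStep # B"
    by auto
  have A: "A \<noteq> []" "\<And>q. prefix q A \<Longrightarrow> q \<noteq> [] \<Longrightarrow> height k q < 0"
    and B: "\<And>q. prefix q B \<Longrightarrow> 0 \<le> height k A + int k + height k q"
    using AB by (auto simp: valley_pairs_def)
  have "hd A = RightStep"
    using A(1) A(2)[of "[hd A]"] by (cases A; cases "hd A") auto
  then have "hd p = RightStep"
    using A(1) p by simp
  \<comment> \<open>Inside \<open>A\<close> heights are negative; inside \<open>B\<close> a right
    step ends at nonnegative height, hence starts at positive height.\<close>
  moreover have "height k q \<noteq> 0" if q: "q \<noteq> []" "prefix (q @ [RightStep]) p" for q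
  proof (cases "prefix q A")
    case True
    then show ?thesis using A(2)[of q] q by simp
  next
    case False
    have "prefix q p" using q append_prefixD by blast
    then obtain q' where q': "q = A @ UpStep # q'"
      using False unfolding p by (auto simp: prefix_append prefix_Cons)
    then have "prefix (q' @ [RightStep]) B"
      using q p by simp
    then show ?thesis
      using B[of "q' @ [RightStep]"] q' by simp
  qed
  ultimately show "p \<in> {p \<in> valved_paths k n. hd p = RightStep}"
    using AB assms p by (auto simp: valved_paths_iff valley_pairs_def)
next
  fix p assume p: "p \<in> {p \<in> valved_paths k n. hd p = RightStep}"
  then have pt: "p \<in> paths_to (int (k * n), int n)"
    and v: "\<And>q. q \<noteq> [] \<Longrightarrow> prefix (q @ [RightStep]) p \<Longrightarrow> height k q \<noteq> 0"
    using assms by (auto simp: valved_paths_iff)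
  have ne: "p \<noteq> []" using paths_to_neq_Nil[OF pt] assms by simp
  \<comment> \<open>Such a prefix exists because the whole path ends at height 0.\<close>
  obtain r where r: "prefix r p" "r \<noteq> [] \<and> 0 \<le> height k r"
    and short: "\<And>q. strict_prefix q r \<Longrightarrow> \<not> (q \<noteq> [] \<and> 0 \<le> height k q)"
    using shortest_prefix[of "\<lambda>r. r \<noteq> [] \<and> 0 \<le> height k r" p] ne height_paths_to[OF pt]
    by auto
  obtain A s where rA: "r = A @ [s]"
    using r(2) by (cases r rule: rev_cases) auto
  obtain B where pB: "p = r @ B"
    using r(1) by (auto simp: prefix_def)
  \<comment> \<open>Otherwise \<open>r\<close> would be just the initial right step, of height
    -1.\<close>
  have Ane: "A \<noteq> []"
    using p r(2) by (auto simp: rA pB)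
  have Aneg: "height k q < 0" if "prefix q A" "q \<noteq> []" for q
  proof -
    have "length q \<le> length A"
      using that(1) by (rule prefix_length_le)
    then have "strict_prefix q r"
      using that(1) by (auto simp: rA strict_prefix_def)
    then show ?thesis using short that(2) by force
  qed
  have s: "s = UpStep"
    using Aneg[of A] Ane r(2) by (cases s) (auto simp: rA)
  have "0 \<le> height k A + int k + height k q" if "prefix q B" for q
    using valved_stays_nonneg[of r B k q] v r(2) that by (simp add: pB rA s)
  then have "(A, B) \<in> valley_pairs k n"
    using pt Ane Aneg by (simp add: valley_pairs_def pB rA s)
  then show "p \<in> (\<lambda>(A, B). A @ UpStep # B) ` valley_pairs k n"
    by (force simp: pB rA s)
qed

text \<open>Read backwards, the negativity of \<open>A\<close> says that \<open>rev A\<close> stays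
  above its final height until its end. After the up step it thus descends from height
  \<open>k\<close> to a first visit of \<open>k - j \<ge> 0\<close>, where \<open>j\<close> is the
  depth of \<open>A\<close>. Cutting an excursion at this first visit inverts the map for each
  \<open>j\<close>.\<close>

lemma excursion_bij:
  assumes "k \<ge> 1" "n \<ge> 1"
  shows "bij_betw (\<lambda>(A, B). (nat (- height k A), UpStep # rev A @ B)) (valley_pairs k n)
    ({1..k} \<times> excursions k n)"
  unfolding bij_betw_def
proof (intro conjI equalityI subsetI)
  \<comment> \<open>A longer \<open>A'\<close> of the same height would have a nonempty prefix
    \<open>rev u\<close> of height 0.\<close>
  have longer: "length A' \<le> length A"
    if *: "(A, B) \<in> valley_pairs k n" "(A', B') \<in> valley_pairs k n"
      "rev A @ B = rev A' @ B'" "height k A = height k A'" for A B A' B'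
  proof (rule ccontr)
    assume len: "\<not> length A' \<le> length A"
    moreover have "prefix (rev A) (rev A' @ B')"
      by (simp flip: *(3))
    ultimately obtain u where "rev A' = rev A @ u"
      using prefix_length_prefix[of "rev A" "rev A' @ B'" "rev A'"] by (auto simp: prefix_def)
    then have u: "A' = rev u @ A"
      by (metis rev_append rev_rev_ident)
    then have "u \<noteq> []" "height k (rev u) = 0"
      using len *(4) by auto
    moreover have "prefix (rev u) A'" using u by simp
    ultimately show False
      using *(2) unfolding valley_pairs_def by fastforce
  qed
  have neg: "height k A < 0" if "(A, B) \<in> valley_pairs k n" for A B
    using that by (auto simp: valley_pairs_def)
  show "inj_on (\<lambda>(A, B). (nat (- height k A), UpStep # rev A @ B)) (valley_pairs k n)"
  proof (rule inj_onI, clarify)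
    fix A B A' B'
    assume *: "(A, B) \<in> valley_pairs k n" "(A', B') \<in> valley_pairs k n"
      "rev A @ B = rev A' @ B'" "nat (- height k A) = nat (- height k A')"
    then have "height k A = height k A'"
      using neg[of A B] neg[of A' B'] by linarith
    then have "length A = length A'"
      using * longer[of A B A' B'] longer[of A' B' A B] by simp
    then show "A = A' \<and> B = B'" using *(3) by simp
  qed
  fix x assume "x \<in> (\<lambda>(A, B). (nat (- height k A), UpStep # rev A @ B)) ` valley_pairs k n"
  then obtain A B where AB: "(A, B) \<in> valley_pairs k n"
    and x: "x = (nat (- height k A), UpStep # rev A @ B)"
    by auto
  have A: "\<And>q. prefix q A \<Longrightarrow> q \<noteq> [] \<Longrightarrow> height k q < 0"
    and B: "\<And>q. prefix q B \<Longrightarrow> 0 \<le> height k A + int k + height k q"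
    using AB by (auto simp: valley_pairs_def)
  have "height k A < 0" "0 \<le> height k A + int k"
    using neg[OF AB] B[of "[]"] by auto
  moreover have "0 \<le> height k q" if "prefix q (UpStep # rev A @ B)" for q
  proof (cases q)
    case (Cons s q')
    then have q: "q = UpStep # q'" "prefix q' (rev A @ B)"
      using that by auto
    show ?thesis
    proof (cases "prefix q' (rev A)")
      case True
      then obtain u where "rev A = q' @ u" by (auto simp: prefix_def)
      then have u: "A = rev u @ rev q'"
        by (metis rev_append rev_rev_ident)
      \<comment> \<open>As \<open>rev u\<close> is a prefix of \<open>A\<close>, the height of
        \<open>q'\<close> is at least that of all of \<open>A\<close>.\<close>
      then have "height k (rev u) \<le> 0"
        using A[of "rev u"] by (cases "u = []") auto
      then show ?thesis
        using \<open>0 \<le> height k A + int k\<close> q(1) u by simp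
    next
      case False
      then obtain q'' where "q' = rev A @ q''" "prefix q'' B"
        using q(2) by (auto simp: prefix_append)
      then show ?thesis using B[of q''] q(1) by simp
    qed
  qed simp
  moreover have "UpStep # rev A @ B \<in> paths_to (int (k * n), int n)"
    using AB by (simp add: valley_pairs_def paths_to_iff del: of_nat_mult)
  ultimately show "x \<in> {1..k} \<times> excursions k n"
    using assms by (auto simp: x excursions_iff)
next
  fix x assume "x \<in> {1..k} \<times> excursions k n"
  then obtain j p where x: "x = (j, p)" and j: "1 \<le> j" "j \<le> k" and p: "p \<in> excursions k n"
    by auto
  obtain p' where p': "p = UpStep # p'"
    using excursion_starts_up[OF assms p] .
  have pt: "p \<in> paths_to (int (k * n), int n)"
    and nonneg: "\<And>q. prefix q p \<Longrightarrow> 0 \<le> height k q"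
    using p assms by (auto simp: excursions_iff)
  \<comment> \<open>Without its first step the excursion ends at height \<open>- k\<close>, so it
    gets down to \<open>- j\<close> for every \<open>j \<le> k\<close>.\<close>
  have "height k p' \<le> - int j"
    using height_paths_to[OF pt] j by (simp add: p')
  then obtain C where C: "prefix C p'" "height k C \<le> - int j"
    and short: "\<And>q. strict_prefix q C \<Longrightarrow> \<not> height k q \<le> - int j"
    using shortest_prefix[of "\<lambda>r. height k r \<le> - int j" p'] by blast
  obtain C' s where CC: "C = C' @ [s]"
    using C(2) j by (cases C rule: rev_cases) auto
  then have "C \<noteq> []" by simp
  have "height k C' > - int j"
    using short[of C'] by (simp add: CC strict_prefix_def)
  \<comment> \<open>The last step of \<open>C\<close> descends, so it is a right step; it lowers the
    height by 1 only and cannot skip the level.\<close>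
  then have hC: "height k C = - int j"
    using C(2) by (cases s) (auto simp: CC)
  obtain B where B: "p' = C @ B"
    using C(1) by (auto simp: prefix_def)
  have "height k q < 0" if q: "prefix q (rev C)" "q \<noteq> []" for q
  proof -
    obtain u where "rev C = q @ u" using q(1) by (auto simp: prefix_def)
    then have u: "C = rev u @ rev q"
      by (metis rev_append rev_rev_ident)
    then have "strict_prefix (rev u) C"
      using q(2) by (auto simp: strict_prefix_def)
    then have "height k (rev u) > - int j" using short by force
    then show ?thesis using hC by (simp add: u)
  qed
  moreover have "0 \<le> height k C + int k + height k q" if "prefix q B" for q
    using nonneg[of "UpStep # C @ q"] that by (simp add: p' B)
  ultimately have "(rev C, B) \<in> valley_pairs k n"
    using pt \<open>C \<noteq> []\<close> by (simp add: valley_pairs_def paths_to_iff p' B del: of_nat_mult)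
  then show "x \<in> (\<lambda>(A, B). (nat (- height k A), UpStep # rev A @ B)) ` valley_pairs k n"
    using hC by (force simp: x p' B)
qed

text \<open>A first step up contributes one copy of the excursions, a first step to the right
  \<open>k\<close> copies.\<close>

lemma num_valved_eq:
  assumes "k \<ge> 1" "n \<ge> 1"
  shows "num_valved k n = (k + 1) * num_excursions k n"
proof -
  let ?U = "{p \<in> valved_paths k n. hd p = UpStep}" and ?R = "{p \<in> valved_paths k n. hd p = RightStep}"
  have "card ?R = card ({1..k} \<times> excursions k n)"
    using bij_betw_same_card[OF valved_right_bij[OF assms]]
      bij_betw_same_card[OF excursion_bij[OF assms]] by simp
  moreover have "valved_paths k n = ?U \<union> ?R"
    using step.exhaust by auto
  moreover have "card (?U \<union> ?R) = card ?U + card ?R"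
    by (rule card_Un_disjoint) (auto simp: finite_valved_paths)
  ultimately show ?thesis
    by (simp add: num_valved_def num_excursions_def valved_up_eq_excursions[OF assms]
        card_cartesian_product algebra_simps del: One_nat_def)
qed

section \<open>Counting excursions by a ballot recursion\<close>

text \<open>Paths from height \<open>b - k * a\<close> to the diagonal: a vertex has minus the
  height of the suffix that remains. With suffixes, prepending a step adds a single condition, the
  one on the whole list.\<close>

definition ballot_lists :: "nat \<Rightarrow> nat \<Rightarrow> nat \<Rightarrow> step list set" where
  "ballot_lists k a b = {p. count_list p UpStep = a \<and> count_list p RightStep = b \<and>
     (\<forall>q. suffix q p \<longrightarrow> height k q \<le> 0)}"

lemma finite_ballot_lists: "finite (ballot_lists k a b)"
  by (rule finite_subset[OF _ finite_paths_to[of "(int b, int a)"]])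
    (auto simp: ballot_lists_def paths_to_iff)

text \<open>The whole list is a suffix of itself and would have height
  \<open>k * a - b > 0\<close>.\<close>

lemma ballot_lists_empty: "b < k * a \<Longrightarrow> ballot_lists k a b = {}"
  by (force simp: ballot_lists_def height_def simp flip: of_nat_mult)

lemma ballot_lists_0: "ballot_lists k 0 b = {replicate b RightStep}"
proof -
  have "p = replicate (count_list p RightStep) RightStep \<and> (\<forall>q. suffix q p \<longrightarrow> height k q \<le> 0)"
    if "count_list p UpStep = 0" for p
    using that
  proof (induction p)
    case (Cons s p)
    then show ?case by (cases s) (auto simp: suffix_Cons)
  qed simp
  moreover have "count_list (replicate b RightStep) UpStep = 0"
    "count_list (replicate b RightStep) RightStep = b"
    by (induction b) auto
  ultimately show ?thesis
    unfolding ballot_lists_def by blast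
qed

text \<open>All proper suffixes belong to the tail; the assumption is exactly the condition on the
  whole list.\<close>

lemma ballot_lists_Suc:
  assumes "k * Suc a \<le> Suc b"
  shows "ballot_lists k (Suc a) (Suc b) =
    (#) UpStep ` ballot_lists k a (Suc b) \<union> (#) RightStep ` ballot_lists k (Suc a) b"
proof (intro equalityI subsetI)
  fix p assume p: "p \<in> ballot_lists k (Suc a) (Suc b)"
  then obtain s p' where "p = s # p'"
    by (cases p) (auto simp: ballot_lists_def)
  with p show "p \<in> (#) UpStep ` ballot_lists k a (Suc b) \<union> (#) RightStep ` ballot_lists k (Suc a) b"
    by (cases s) (auto simp: ballot_lists_def suffix_Cons)
next
  have *: "height k q \<le> 0" if "count_list q UpStep = Suc a" "count_list q RightStep = Suc b" for q
    using assms that by (simp add: height_def flip: of_nat_mult of_nat_Suc del: mult_Suc_right)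
  fix p assume "p \<in> (#) UpStep ` ballot_lists k a (Suc b) \<union> (#) RightStep ` ballot_lists k (Suc a) b"
  then show "p \<in> ballot_lists k (Suc a) (Suc b)"
    using *[of p] by (auto simp: ballot_lists_def suffix_Cons simp del: height_simps)
qed

lemma card_ballot_lists_Suc:
  assumes "k * Suc a \<le> Suc b"
  shows "card (ballot_lists k (Suc a) (Suc b)) =
    card (ballot_lists k a (Suc b)) + card (ballot_lists k (Suc a) b)"
  unfolding ballot_lists_Suc[OF assms]
  by (subst card_Un_disjoint) (auto simp: finite_ballot_lists card_image)

text \<open>The formula includes the boundary \<open>b + 1 = k * a\<close>, where both sides vanish; the recursion on
  the first step needs it.\<close>

lemma card_ballot_lists:
  assumes "k \<ge> 1" "k * a \<le> b + 1"
  shows "real (b + 1) * real (card (ballot_lists k a b)) =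
    (real (b + 1) - real (k * a)) * real ((a + b) choose a)"
  using assms(2)
proof (induction "a + b" arbitrary: a b)
  case 0
  then show ?case by (simp add: ballot_lists_0)
next
  case (Suc m)
  show ?case
  proof (cases "a = 0 \<or> k * a = b + 1")
    case True
    then show ?thesis
      by (auto simp: ballot_lists_0 ballot_lists_empty simp del: of_nat_mult)
  next
    case False
    then have "k * a \<le> b" using Suc.prems by simp
    moreover obtain a' where a: "a = Suc a'" using False by (cases a) auto
    ultimately obtain b' where b: "b = Suc b'" using assms(1) by (cases b) auto
    have le: "k * Suc a' \<le> Suc b'" using \<open>k * a \<le> b\<close> a b by simp
    define X where "X = real (card (ballot_lists k a' (Suc b')))"
    define Y where "Y = real (card (ballot_lists k (Suc a') b'))"
    define P where "P = real ((a' + Suc b') choose a')"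
    define Q where "Q = real ((Suc a' + b') choose Suc a')"
    have X: "(real b' + 2) * X = (real b' + 2 - real k * real a') * P"
      using Suc.hyps(1)[of a' "Suc b'"] Suc.hyps(2) le a b by (simp add: X_def P_def add.commute)
    \<comment> \<open>The equality \<open>k * Suc a' = Suc b'\<close> may hold here; then the
      induction hypothesis is applied on the boundary.\<close>
    have Y: "(real b' + 1) * Y = (real b' + 1 - real k * (real a' + 1)) * Q"
      using Suc.hyps(1)[of "Suc a'" b'] Suc.hyps(2) le a b
      by (simp add: Y_def Q_def add.commute distrib_left)
    \<comment> \<open>Ratio of neighbouring binomial coefficients in row \<open>a' + b' + 1\<close>;
      it makes the two closed forms add up.\<close>
    have PQ: "(real b' + 1) * P = (real a' + 1) * Q"
    proof -
      have "Suc a' * ((Suc a' + b') choose Suc a') = Suc b' * ((a' + Suc b') choose a')"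
        using Suc_times_binomial_add[of a' b'] by simp
      from arg_cong[OF this, of real] show ?thesis
        unfolding of_nat_mult P_def Q_def by (simp add: add.commute)
    qed
    \<comment> \<open>The factor \<open>real b' + 1\<close> clears the denominator of the closed
      form for \<open>Y\<close> and is cancelled afterwards.\<close>
    have "(real b' + 1) * ((real b' + 2) * (X + Y)) =
        (real b' + 1) * ((real b' + 2 - real k * (real a' + 1)) * (P + Q))"
      using X Y PQ by algebra
    then have "(real b' + 2) * (X + Y) = (real b' + 2 - real k * (real a' + 1)) * (P + Q)"
      by (subst (asm) mult_cancel_left) linarith
    moreover have "real (card (ballot_lists k a b)) = X + Y"
      unfolding a b card_ballot_lists_Suc[OF le] by (simp add: X_def Y_def)
    moreover have "real ((a + b) choose a) = P + Q"
      by (simp add: a b P_def Q_def)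
    ultimately show ?thesis by (simp add: a b algebra_simps)
  qed
qed

text \<open>The total height is 0, so a prefix and its complementary suffix have opposite
  heights.\<close>

lemma excursions_eq_ballot_lists:
  assumes "k \<ge> 1"
  shows "excursions k n = ballot_lists k n (k * n)"
proof -
  have "(\<forall>q. prefix q p \<longrightarrow> 0 \<le> height k q) \<longleftrightarrow> (\<forall>q. suffix q p \<longrightarrow> height k q \<le> 0)"
    if "height k p = 0" for p
  proof -
    have "0 \<le> height k u \<longleftrightarrow> height k w \<le> 0" if "p = u @ w" for u w
      using \<open>height k p = 0\<close> that by simp linarith
    then show ?thesis unfolding prefix_def suffix_def by metis
  qed
  then show ?thesis
    using height_paths_to[of _ k n]
    by (auto simp: excursions_iff[OF assms] ballot_lists_def paths_to_iff simp del: of_nat_mult)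
qed

theorem proposition12:
  fixes k n :: nat
  assumes "k \<ge> 1" and "n \<ge> 1"
  shows "num_valved k n = (k + 1) * num_excursions k n \<and>
    real ((k + 1) * num_excursions k n) = real (k + 1) / real (k * n + 1) * real ((k * n + n) choose n)"
proof
  show "num_valved k n = (k + 1) * num_excursions k n"
    by (rule num_valved_eq[OF assms])
  \<comment> \<open>For \<open>a = n\<close> and \<open>b = k * n\<close> the factor
    \<open>b + 1 - k * a\<close> is 1.\<close>
  have "real (k * n + 1) * real (num_excursions k n) = real ((k * n + n) choose n)"
    using card_ballot_lists[OF assms(1), of n "k * n"]
    by (simp add: num_excursions_def excursions_eq_ballot_lists[OF assms(1)] add.commute)
  then have "real (num_excursions k n) = real ((k * n + n) choose n) / real (k * n + 1)"
    by (simp add: eq_divide_eq mult.commute del: of_nat_add of_nat_mult)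
  then show "real ((k + 1) * num_excursions k n) =
      real (k + 1) / real (k * n + 1) * real ((k * n + n) choose n)"
    by (simp only: of_nat_mult times_divide_eq_left times_divide_eq_right)
qed

end
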